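(* Let $G = \bigoplus_{i=1}^r C_{n_i}$ where $r\ge 3$ is an integer and $1 < n_1 \mid \dots \mid n_r$. Let $k \in \mathbb{N}_0$. If $t \in \{2,\dots,r\}$ is such that $n_{s} < \prod_{i=1}^{s-1} n_i$ for each $s \in \{t+1,\dots,r\}$, then \[\mathsf{SD}_k(G) \ge \mathsf{D}^{\ast}(G) - \max \left\{0,\; n_t - k-r+2 -\left\lfloor \frac{-1 + \sqrt{1 + 8\max\{0,n_t-k-r+2\}}}{2}\right\rfloor \right\}.\] In particular, if $r \ge n_t +1 -k$, then $\mathsf{SD}_k(G)\ge \mathsf{D}^{\ast}(G)$.
   Context: $\mathbb{N}_0$ denotes the non-negative integers and $C_n$ a cyclic group of order $n$; groups are written additively. For a finite abelian group $G\cong C_{n_1}\oplus\dots\oplus C_{n_r}$ with $1<n_1\mid\dots\mid n_r$, set $\mathsf{D}^{\ast}(G)=1+\sum_{i=1}^r(n_i-1)$. A sequence over $G$ is a finite multiset $S$ of elements of $G$; its length $|S|$ is the number of terms counted with multiplicity, and $\mathsf{v}_g(S)$ is the multiplicity of $g$ in $S$. A minimal zero-sum sequence is a non-empty sequence whose terms sum to $0$ and none of whose proper non-empty subsequences has sum $0$. The cumulated multiplicity of $S$ is $\mathrm{cm}(S)=\sum_{g\in G}\max\{0,\mathsf{v}_g(S)-1\}$. The $k$-th Strong Davenport constant $\mathsf{SD}_k(G)$ is the maximal length of a minimal zero-sum sequence $S$ over $G$ with $\mathrm{cm}(S)\le k$. *)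

theory Defs
  imports
    Complex_Main
    "HOL-Library.Multiset"
    "HOL-Algebra.FiniteProduct"
    "HOL-Algebra.Elementary_Groups"
    "HOL-Algebra.Product_Groups"
begin

text \<open>
  Groups are abelian groups of HOL-Algebra, written multiplicatively there:
  \<open>\<one>\<close> plays the role of \<open>0\<close> and \<open>[^]\<close> that of the multiplication by integers.
  Sequences over a group are finite multisets of elements of its carrier.
\<close>

definition invariant_factors :: "('a, 'b) monoid_scheme \<Rightarrow> nat \<Rightarrow> (nat \<Rightarrow> nat) \<Rightarrow> bool" where
  "invariant_factors G r n \<longleftrightarrow>
     (\<forall>i\<in>{1..r}. 1 < n i) \<and> (\<forall>i\<in>{1..<r}. n i dvd n (Suc i)) \<and>
     G \<cong> sum_group {1..r} (\<lambda>i. integer_mod_group (n i))"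

text \<open>
  The value does not depend on the decomposition, see \<open>Dstar_eq\<close> below.
\<close>

definition Dstar :: "('a, 'b) monoid_scheme \<Rightarrow> nat" where
  "Dstar G = (THE d. \<exists>r n. invariant_factors G r n \<and> d = 1 + (\<Sum>i=1..r. (n i - 1)))"

definition seq_sum :: "('a, 'b) monoid_scheme \<Rightarrow> 'a multiset \<Rightarrow> 'a" where
  "seq_sum G S = (\<Otimes>\<^bsub>G\<^esub> g\<in>set_mset S. g [^]\<^bsub>G\<^esub> count S g)"

definition minimal_zero_sum :: "('a, 'b) monoid_scheme \<Rightarrow> 'a multiset \<Rightarrow> bool" where
  "minimal_zero_sum G S \<longleftrightarrow>
     set_mset S \<subseteq> carrier G \<and> S \<noteq> {#} \<and> seq_sum G S = \<one>\<^bsub>G\<^esub> \<and>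
     (\<forall>T. T \<subset># S \<and> T \<noteq> {#} \<longrightarrow> seq_sum G T \<noteq> \<one>\<^bsub>G\<^esub>)"

text \<open>
  The truncated subtraction on the natural numbers is \<open>max {0, v - 1}\<close>.
\<close>

definition cumulated_mult :: "('a, 'b) monoid_scheme \<Rightarrow> 'a multiset \<Rightarrow> nat" where
  "cumulated_mult G S = (\<Sum>g\<in>carrier G. (count S g - 1))"

text \<open>
  For a finite group the set below is finite, since a minimal zero-sum sequence is at most
  as long as the group order, and contains \<open>1\<close>, witnessed by the sequence with single term \<open>\<one>\<close>.
\<close>

definition strong_davenport :: "nat \<Rightarrow> ('a, 'b) monoid_scheme \<Rightarrow> nat" where
  "strong_davenport k G = Max {size S |S. minimal_zero_sum G S \<and> cumulated_mult G S \<le> k}"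

subsection \<open>Uniqueness of the invariant factors\<close>

lemma card_torsion_integer_mod_group:
  assumes "0 < n" "0 < d"
  shows "card {x \<in> carrier (integer_mod_group n). x [^]\<^bsub>integer_mod_group n\<^esub> (d::nat) = 0} = gcd d n"
proof -
  define g where "g = gcd d n"
  define q where "q = n div g"
  have g: "0 < g" and n: "n = g * q" using assms by (auto simp: g_def q_def)
  have q: "0 < q" using n assms by (cases q) auto
  have iff: "int n dvd int d * x \<longleftrightarrow> int q dvd x" for x
  proof -
    obtain d' where d': "d = g * d'" unfolding g_def by (meson dvdE gcd_dvd1)
    have "coprime d' q"
      using g d' n by (metis g_def gcd_mult_distrib_nat coprime_iff_gcd_eq_1 mult_cancel1 mult.right_neutral less_irrefl)
    then have c: "coprime (int q) (int d')" by (simp add: coprime_commute)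
    have "int n dvd int d * x \<longleftrightarrow> int g * int q dvd int g * (int d' * x)"
      by (simp add: n d' mult.assoc)
    also have "\<dots> \<longleftrightarrow> int q dvd int d' * x" using g by simp
    also have "\<dots> \<longleftrightarrow> int q dvd x" using c by (simp add: coprime_dvd_mult_right_iff)
    finally show ?thesis .
  qed
  have "{x \<in> carrier (integer_mod_group n). x [^]\<^bsub>integer_mod_group n\<^esub> d = 0}
        = {x. 0 \<le> x \<and> x < int n \<and> int q dvd x}"
    using assms iff by (auto simp: carrier_integer_mod_group mod_eq_0_iff_dvd)
  also have "\<dots> = (\<lambda>j. int (q * j)) ` {..<g}"
  proof (intro equalityI subsetI)
    fix x assume x: "x \<in> {x. 0 \<le> x \<and> x < int n \<and> int q dvd x}"
    then obtain j where j: "x = int q * j" by auto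
    have "0 \<le> j" using x j q by (auto simp: zero_le_mult_iff)
    moreover have "j < int g" using x j q by (auto simp: n mult.commute)
    ultimately show "x \<in> (\<lambda>j. int (q * j)) ` {..<g}"
      using j by (intro image_eqI[of _ _ "nat j"]) auto
  qed (use q in \<open>auto simp: n\<close>)
  also have "card \<dots> = g" using q by (subst card_image) (auto simp: inj_on_def)
  finally show ?thesis by (simp add: g_def)
qed

lemma card_torsion_sum_group:
  assumes "finite I" "\<And>i. i \<in> I \<Longrightarrow> 0 < n i" "0 < d"
  defines "A \<equiv> sum_group I (\<lambda>i. integer_mod_group (n i))"
  shows "card {x \<in> carrier A. x [^]\<^bsub>A\<^esub> (d::nat) = \<one>\<^bsub>A\<^esub>} = (\<Prod>i\<in>I. gcd d (n i))"
proof -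
  have carr: "carrier A = (\<Pi>\<^sub>E i\<in>I. carrier (integer_mod_group (n i)))"
    using assms(1) by (simp add: A_def carrier_sum_group)
  have pow: "x [^]\<^bsub>A\<^esub> m = (\<lambda>i\<in>I. x i [^]\<^bsub>integer_mod_group (n i)\<^esub> m)" for x and m :: nat
    by (induction m) (auto simp: A_def simp del: pow_integer_mod_group)
  have "{x \<in> carrier A. x [^]\<^bsub>A\<^esub> d = \<one>\<^bsub>A\<^esub>}
      = (\<Pi>\<^sub>E i\<in>I. {x \<in> carrier (integer_mod_group (n i)). x [^]\<^bsub>integer_mod_group (n i)\<^esub> d = 0})"
    unfolding pow carr by (auto simp: A_def PiE_iff fun_eq_iff restrict_def extensional_def simp del: pow_integer_mod_group)
  then show ?thesis
    using assms by (simp add: card_PiE card_torsion_integer_mod_group del: pow_integer_mod_group)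
qed

lemma iso_card_torsion:
  assumes "A \<cong> B" "group A" "group B"
  shows "card {x \<in> carrier A. x [^]\<^bsub>A\<^esub> (d::nat) = \<one>\<^bsub>A\<^esub>} = card {x \<in> carrier B. x [^]\<^bsub>B\<^esub> d = \<one>\<^bsub>B\<^esub>}"
proof -
  obtain h where h: "h \<in> hom A B" and bij: "bij_betw h (carrier A) (carrier B)"
    using assms(1) by (auto simp: is_iso_def iso_def)
  interpret group_hom A B h using assms h by (simp add: group_hom_def group_hom_axioms_def)
  have "bij_betw h {x \<in> carrier A. x [^]\<^bsub>A\<^esub> d = \<one>\<^bsub>A\<^esub>} {x \<in> carrier B. x [^]\<^bsub>B\<^esub> d = \<one>\<^bsub>B\<^esub>}"
  proof (rule bij_betwI')
    fix x y assume "x \<in> {x \<in> carrier A. x [^]\<^bsub>A\<^esub> d = \<one>\<^bsub>A\<^esub>}" "y \<in> {x \<in> carrier A. x [^]\<^bsub>A\<^esub> d = \<one>\<^bsub>A\<^esub>}"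
    then show "(h x = h y) = (x = y)" using bij by (auto simp: bij_betw_def inj_on_def)
  next
    fix x assume "x \<in> {x \<in> carrier A. x [^]\<^bsub>A\<^esub> d = \<one>\<^bsub>A\<^esub>}"
    then show "h x \<in> {x \<in> carrier B. x [^]\<^bsub>B\<^esub> d = \<one>\<^bsub>B\<^esub>}"
      by (auto simp flip: hom_nat_pow)
  next
    fix y assume y: "y \<in> {x \<in> carrier B. x [^]\<^bsub>B\<^esub> d = \<one>\<^bsub>B\<^esub>}"
    then obtain x where x: "x \<in> carrier A" "y = h x" using bij by (auto simp: bij_betw_def)
    have "h (x [^]\<^bsub>A\<^esub> d) = h \<one>\<^bsub>A\<^esub>" using x y by (simp add: hom_nat_pow)
    then have "x [^]\<^bsub>A\<^esub> d = \<one>\<^bsub>A\<^esub>"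
      using bij x by (auto simp: bij_betw_def inj_on_def)
    then show "\<exists>x\<in>{x \<in> carrier A. x [^]\<^bsub>A\<^esub> d = \<one>\<^bsub>A\<^esub>}. y = h x" using x by auto
  qed
  then show ?thesis by (rule bij_betw_same_card)
qed

lemma invariant_factors_torsion:
  assumes "group G" "invariant_factors G r n" "0 < d"
  shows "card {x \<in> carrier G. x [^]\<^bsub>G\<^esub> (d::nat) = \<one>\<^bsub>G\<^esub>} = (\<Prod>i=1..r. gcd d (n i))"
proof -
  have "\<And>i. i \<in> {1..r} \<Longrightarrow> 0 < n i" using assms(2) by (auto simp: invariant_factors_def dest!: bspec)
  then show ?thesis
    using assms iso_card_torsion[of G "sum_group {1..r} (\<lambda>i. integer_mod_group (n i))" d]
      card_torsion_sum_group[of "{1..r}" n d]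
    by (simp add: invariant_factors_def)
qed

lemma chain_dvd:
  assumes "\<forall>i\<in>{1..<r}. n i dvd n (Suc i)" "1 \<le> i" "i \<le> j" "j \<le> r"
  shows "n i dvd (n j :: nat)"
  using assms(3,4)
proof (induction j rule: dec_induct)
  case (step j)
  then have "n j dvd n (Suc j)" using assms by auto
  with step show ?case by (meson Suc_leD dvd_trans)
qed simp

lemma prod_full_imp_eq:
  fixes f :: "'i \<Rightarrow> nat"
  assumes "finite I" "\<And>i. i \<in> I \<Longrightarrow> 0 < f i \<and> f i \<le> m" "(\<Prod>i\<in>I. f i) = m ^ card I" "j \<in> I"
  shows "f j = m"
proof (rule ccontr)
  assume "f j \<noteq> m"
  then have less: "f j < m" using assms by (meson le_neq_implies_less)
  have "(\<Prod>i\<in>I. f i) < (\<Prod>i\<in>I. m)"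
  proof (rule prod_mono_strict[of j])
    show "0 \<le> f i \<and> f i \<le> m" "0 < m" if "i \<in> I" for i
      using assms(2)[OF that] by auto
  qed (use assms less in auto)
  then show False using assms by simp
qed

lemma invariant_factors_length_le:
  assumes "group G" "invariant_factors G r n" "invariant_factors G s m"
  shows "r \<le> s"
proof (cases "r = 0")
  case False
  have n: "\<And>i. i \<in> {1..r} \<Longrightarrow> 1 < n i" and dn: "\<And>i. i \<in> {1..r} \<Longrightarrow> n 1 dvd n i"
    using assms(2) chain_dvd[of r n 1] by (auto simp: invariant_factors_def)
  have n1: "1 < n 1" using n[of 1] False by simp
  have "n 1 ^ r = (\<Prod>i=1..r. gcd (n 1) (n i))"
    using dn by (simp add: gcd_nat.absorb1)
  also have "\<dots> = (\<Prod>i=1..s. gcd (n 1) (m i))"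
    using invariant_factors_torsion[of G r n "n 1"] invariant_factors_torsion[of G s m "n 1"] assms n1
    by simp
  also have "\<dots> \<le> (\<Prod>i=1..s. n 1)" using n1 by (intro prod_mono) (auto intro!: dvd_imp_le)
  finally show ?thesis using n1 by simp
qed simp

lemma invariant_factors_dvd:
  assumes "group G" "invariant_factors G r n" "invariant_factors G r m"
    and k: "k \<in> {1..r}" and eq: "\<And>i. i \<in> {1..<k} \<Longrightarrow> n i = m i"
  shows "n k dvd m k"
proof -
  have n: "\<And>i. i \<in> {1..r} \<Longrightarrow> 1 < n i" and cn: "\<forall>i\<in>{1..<r}. n i dvd n (Suc i)"
    using assms(2) by (auto simp: invariant_factors_def)
  have nk: "0 < n k" using n[OF k] by simp
  have split: "{1..r} = {1..<k} \<union> {k..r}" using k by auto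
  have dis: "(\<Prod>i=1..r. f i) = (\<Prod>i\<in>{1..<k}. f i) * (\<Prod>i\<in>{k..r}. f i)" for f :: "nat \<Rightarrow> nat"
    unfolding split by (rule prod.union_disjoint) auto
  have "(\<Prod>i=1..r. gcd (n k) (n i)) = (\<Prod>i=1..r. gcd (n k) (m i))"
    using invariant_factors_torsion[of G r n "n k"] invariant_factors_torsion[of G r m "n k"] assms nk
    by simp
  moreover have "(\<Prod>i\<in>{1..<k}. gcd (n k) (n i)) = (\<Prod>i\<in>{1..<k}. gcd (n k) (m i))"
    using eq by (intro prod.cong) auto
  moreover have "(\<Prod>i\<in>{1..<k}. gcd (n k) (m i)) \<noteq> 0" using nk by simp
  ultimately have "(\<Prod>i\<in>{k..r}. gcd (n k) (m i)) = (\<Prod>i\<in>{k..r}. gcd (n k) (n i))"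
    unfolding dis by (metis mult_cancel1)
  also have "\<dots> = (\<Prod>i\<in>{k..r}. n k)"
    using k chain_dvd[OF cn] by (intro prod.cong) (auto simp: gcd_nat.absorb1)
  finally have "(\<Prod>i\<in>{k..r}. gcd (n k) (m i)) = n k ^ card {k..r}" by simp
  then have "gcd (n k) (m k) = n k"
    by (intro prod_full_imp_eq[of "{k..r}" "\<lambda>i. gcd (n k) (m i)"]) (use nk k in \<open>auto intro!: dvd_imp_le\<close>)
  then show ?thesis by (metis gcd_dvd2)
qed

lemma invariant_factors_unique:
  assumes "group G" "invariant_factors G r n" "invariant_factors G s m"
  shows "r = s \<and> (\<forall>i\<in>{1..r}. n i = m i)"
proof -
  have rs: "r = s" using assms invariant_factors_length_le by (metis le_antisym)
  have "k \<in> {1..r} \<longrightarrow> n k = m k" for k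
  proof (induction k rule: less_induct)
    case (less k)
    then show ?case
      using invariant_factors_dvd[of G r n m k] invariant_factors_dvd[of G r m n k] assms rs
      by (auto intro!: dvd_antisym)
  qed
  with rs show ?thesis by auto
qed

lemma Dstar_eq:
  assumes "group G" "invariant_factors G r n"
  shows "Dstar G = 1 + (\<Sum>i=1..r. (n i - 1))"
  unfolding Dstar_def
proof (rule the_equality)
  show "\<exists>r' n'. invariant_factors G r' n' \<and> 1 + (\<Sum>i=1..r. (n i - 1)) = 1 + (\<Sum>i=1..r'. (n' i - 1))"
    using assms by blast
next
  fix d assume "\<exists>r n. invariant_factors G r n \<and> d = 1 + (\<Sum>i=1..r. (n i - 1))"
  then obtain s m where "invariant_factors G s m" and d: "d = 1 + (\<Sum>i=1..s. (m i - 1))" by blast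
  then have "r = s \<and> (\<forall>i\<in>{1..r}. n i = m i)" using assms invariant_factors_unique by blast
  then show "d = 1 + (\<Sum>i=1..r. (n i - 1))" unfolding d by (auto intro!: sum.cong)
qed

end

theory Submission
  imports Defs "HOL-Algebra.Multiplicative_Group"
begin

text \<open>
  The bound is proved by constructing one long minimal zero-sum sequence with few repetitions. Let
  \<open>e 1, \<dots>, e r\<close> be a basis of \<open>G\<close> with orders \<open>n 1, \<dots>, n r\<close>; the group is written multiplicatively,
  but "sum" and "zero-sum" keep their usual meaning for sequences.

  The construction begins with a minimal zero-sum sequence over the cyclic group of \<open>e t\<close>, and the
  other basis elements are then added one by one. To add \<open>e s\<close> to a minimal zero-sum sequence over
  the subgroup \<open>H\<close> generated so far, one of its terms \<open>g\<close> is exchanged for \<open>n s\<close> terms \<open>e s \<otimes> h\<close> with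
  \<open>h \<in> H\<close>, where the elements \<open>h\<close> have sum \<open>g\<close>. The result is again a minimal zero-sum sequence
  (\<open>minimal_zero_sum_replace\<close>), and it is longer by \<open>n s - 1\<close>. From \<open>n t\<close> copies of \<open>e t\<close> this leads to
  length \<open>Dstar G\<close>. If the elements \<open>h\<close> are distinct, no new repetition arises, and if \<open>g\<close> was a
  repeated term, the cumulated multiplicity drops by one.

  Distinct elements with a given sum \<open>g\<close> are found by taking a union of cosets of a subgroup that
  does not contain \<open>g\<close> and exchanging one element (\<open>subset_with_sum\<close>). The hypothesis on \<open>n s\<close> for
  \<open>s > t\<close> guarantees that \<open>H\<close> has more than \<open>n s\<close> elements; for \<open>s < t\<close> this is automatic once two
  basis elements, one of them \<open>e t\<close>, are present. Only the first extension can create a repetition,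
  when there is too little room in the cyclic group of \<open>e t\<close>; that repetition is removed in the next
  extension instead of a copy of \<open>e t\<close> (\<open>attains_initial\<close>). So \<open>r - 2\<close> of the \<open>r - 1\<close> extensions use up
  a copy of \<open>e t\<close>, and \<open>n t - r + 2\<close> copies remain at the end (\<open>attains_all\<close>). When the copies run out, all
  terms are distinct, and other terms are exchanged.

  If \<open>n t - r + 2\<close> exceeds \<open>k\<close>, say by \<open>N\<close>, then \<open>N\<close> of the copies in the initial sequence are merged
  into \<open>f\<close> powers of \<open>e t\<close> with distinct exponents of sum \<open>N\<close>, at the cost of \<open>N - f\<close> terms. The best
  possible \<open>f\<close> is the largest one with \<open>f * (f + 1) div 2 \<le> N\<close>, which is the floor in the theorem.
\<close>

section \<open>Sums of sequences and cumulated multiplicity\<close>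

context comm_group
begin

lemma seq_sum_empty [simp]: "seq_sum G {#} = \<one>"
  by (simp add: seq_sum_def)

lemma seq_sum_add_mset:
  assumes "x \<in> carrier G" "set_mset S \<subseteq> carrier G"
  shows "seq_sum G (add_mset x S) = x \<otimes> seq_sum G S"
proof (cases "x \<in># S")
  case True
  let ?R = "set_mset S - {x}"
  have S: "set_mset S = insert x ?R" using True by auto
  have rest: "(\<Otimes>g\<in>?R. g [^] count (add_mset x S) g) = (\<Otimes>g\<in>?R. g [^] count S g)"
    using assms by (intro finprod_cong') auto
  have cl: "(\<lambda>g. g [^] count T g) \<in> ?R \<rightarrow> carrier G" for T using assms by auto
  have "seq_sum G (add_mset x S) = x [^] Suc (count S x) \<otimes> (\<Otimes>g\<in>?R. g [^] count (add_mset x S) g)"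
    unfolding seq_sum_def set_mset_add_mset_insert using assms cl
    by (subst S, subst insert_absorb2, subst finprod_insert) auto
  also have "\<dots> = x \<otimes> (x [^] count S x \<otimes> (\<Otimes>g\<in>?R. g [^] count S g))"
    unfolding rest using assms cl finprod_closed[OF cl[of S]]
    by (simp add: m_assoc m_comm m_lcomm)
  also have "x [^] count S x \<otimes> (\<Otimes>g\<in>?R. g [^] count S g) = seq_sum G S"
    unfolding seq_sum_def using assms cl by (subst S, subst finprod_insert) auto
  finally show ?thesis .
next
  case False
  have "(\<Otimes>g\<in>set_mset S. g [^] count (add_mset x S) g) = (\<Otimes>g\<in>set_mset S. g [^] count S g)"
    using assms False by (intro finprod_cong') auto
  moreover have "count S x = 0" using False by (simp add: not_in_iff)
  moreover have "(\<lambda>g. g [^] count (add_mset x S) g) \<in> set_mset S \<rightarrow> carrier G" using assms by auto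
  ultimately show ?thesis
    unfolding seq_sum_def set_mset_add_mset_insert
    using assms False by (subst finprod_insert) auto
qed

lemma seq_sum_in_subgroup:
  assumes "subgroup H G" "set_mset S \<subseteq> H"
  shows "seq_sum G S \<in> H"
  using assms(2)
proof (induction S)
  case empty
  then show ?case using assms(1) by (simp add: subgroup.one_closed)
next
  case (add x S)
  then show ?case
    using subgroup.subset[OF assms(1)] subgroup.m_closed[OF assms(1)]
    by (subst seq_sum_add_mset) auto
qed

lemma seq_sum_closed [simp]: "set_mset S \<subseteq> carrier G \<Longrightarrow> seq_sum G S \<in> carrier G"
  using seq_sum_in_subgroup[OF subgroup_self] .

lemma seq_sum_union:
  assumes "set_mset S \<subseteq> carrier G" "set_mset T \<subseteq> carrier G"
  shows "seq_sum G (S + T) = seq_sum G S \<otimes> seq_sum G T"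
  using assms(1) by (induction S) (use assms(2) in \<open>auto simp: seq_sum_add_mset m_assoc\<close>)

lemma seq_sum_translate:
  assumes "e \<in> carrier G" "set_mset A \<subseteq> carrier G"
  shows "seq_sum G (image_mset (\<lambda>h. e \<otimes> h) A) = e [^] size A \<otimes> seq_sum G A"
  using assms(2)
proof (induction A)
  case (add x A)
  then have "set_mset (image_mset (\<lambda>h. e \<otimes> h) A) \<subseteq> carrier G" using assms(1) by auto
  then show ?case using add assms(1)
    by (simp add: seq_sum_add_mset del: set_image_mset) (simp add: m_ac)
qed simp

lemma seq_sum_powers:
  assumes "e \<in> carrier G"
  shows "seq_sum G (image_mset (\<lambda>a. e [^] a) M) = e [^] sum_mset (M :: nat multiset)"
proof (induction M)
  case (add x M)
  have "set_mset (image_mset (\<lambda>a. e [^] a) M) \<subseteq> carrier G" using assms by auto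
  then show ?case using add assms
    by (simp add: seq_sum_add_mset nat_pow_mult del: set_image_mset)
qed simp

text \<open>
  The cumulated multiplicity is the excess of the length over the number of distinct terms. In this
  form it is easy to follow when terms are exchanged.
\<close>

lemma cumulated_mult_eq:
  assumes "finite (carrier G)" "set_mset S \<subseteq> carrier G"
  shows "cumulated_mult G S + card (set_mset S) = size S"
proof -
  have "cumulated_mult G S = (\<Sum>g\<in>set_mset S. count S g - 1)"
    unfolding cumulated_mult_def using assms
    by (intro sum.mono_neutral_right) (auto simp: not_in_iff)
  then have "cumulated_mult G S + card (set_mset S) = (\<Sum>g\<in>set_mset S. (count S g - 1) + 1)"
    by (simp only: sum.distrib) simp
  also have "\<dots> = size S"
    unfolding size_multiset_overloaded_eq by (intro sum.cong) auto
  finally show ?thesis .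
qed

text \<open>
  The lengths are bounded by \<open>card (carrier G) + k\<close>, since there are at most \<open>card (carrier G)\<close>
  distinct terms; so the maximum in the definition is over a finite set, and a single sequence
  gives a lower bound.
\<close>

lemma strong_davenport_ge:
  assumes fin: "finite (carrier G)" and S: "minimal_zero_sum G S"
    and k: "size S \<le> card (set_mset S) + k"
  shows "size S \<le> strong_davenport k G"
proof -
  let ?L = "{size S |S. minimal_zero_sum G S \<and> cumulated_mult G S \<le> k}"
  have "?L \<subseteq> {..card (carrier G) + k}"
  proof clarsimp
    fix T assume T: "minimal_zero_sum G T" "cumulated_mult G T \<le> k"
    then have c: "set_mset T \<subseteq> carrier G" by (simp add: minimal_zero_sum_def)
    then have "card (set_mset T) \<le> card (carrier G)" by (intro card_mono fin)
    then show "size T \<le> card (carrier G) + k" using cumulated_mult_eq[OF fin c] T by linarith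
  qed
  then have "finite ?L" by (rule finite_subset) simp
  moreover have "size S \<in> ?L"
    using S k cumulated_mult_eq[OF fin, of S] by (auto simp: minimal_zero_sum_def)
  ultimately show ?thesis unfolding strong_davenport_def by (rule Max_ge)
qed

section \<open>Exchanging a term for terms of a coset\<close>

text \<open>
  The basic exchange: a term \<open>g\<close> of a minimal zero-sum sequence over \<open>H\<close> is split into \<open>m\<close> terms of
  the coset of an element \<open>e\<close> that has order \<open>m\<close> modulo \<open>H\<close>. A zero-sum subsequence must contain a
  multiple of \<open>m\<close> of the new terms, hence none or all of them. If it contains none, it is a proper
  subsequence of the old sequence. If it contains all, they can be merged into \<open>g\<close> again, and
  minimality of the old sequence applies.
\<close>

lemma minimal_zero_sum_replace:
  assumes H: "subgroup H G" and e: "e \<in> carrier G" and m: "0 < m"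
    and ind: "\<And>j::nat. e [^] j \<in> H \<Longrightarrow> m dvd j" and em: "e [^] m = \<one>"
    and S: "minimal_zero_sum G (add_mset g S)" "set_mset (add_mset g S) \<subseteq> H"
    and A: "set_mset A \<subseteq> H" "size A = m" "seq_sum G A = g"
  shows "minimal_zero_sum G (S + image_mset (\<lambda>h. e \<otimes> h) A)"
proof -
  let ?B = "image_mset (\<lambda>h. e \<otimes> h) A"
  have HG: "H \<subseteq> carrier G" using H by (rule subgroup.subset)
  have cS: "set_mset S \<subseteq> carrier G" "g \<in> carrier G" using S HG by auto
  have cA: "set_mset A \<subseteq> carrier G" using A HG by auto
  have cB: "set_mset ?B \<subseteq> carrier G" using cA e by auto
  have sB: "seq_sum G ?B = g"
    using seq_sum_translate[OF e cA] A em cS by simp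
  have sum_mod: "\<exists>h\<in>H. seq_sum G T = e [^] size T \<otimes> h"
    if "set_mset T \<subseteq> (\<lambda>h. e \<otimes> h) ` H" for T
    using that
  proof (induction T)
    case empty
    then show ?case using H by (auto intro!: bexI[of _ \<one>] simp: subgroup.one_closed)
  next
    case (add x T)
    then obtain h h' where h: "h \<in> H" "x = e \<otimes> h" and h': "h' \<in> H" "seq_sum G T = e [^] size T \<otimes> h'"
      by auto
    have "set_mset T \<subseteq> carrier G" using add.prems e HG by auto
    then have "seq_sum G (add_mset x T) = e \<otimes> h \<otimes> (e [^] size T \<otimes> h')"
      using h h' e HG by (subst seq_sum_add_mset) auto
    also have "\<dots> = e [^] size (add_mset x T) \<otimes> (h \<otimes> h')"
      using h h' e HG by (simp add: m_ac subsetD)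
    finally show ?case using h h' H by (auto simp: subgroup.m_closed)
  qed
  have zero: "seq_sum G (S + ?B) = \<one>"
    using S cS cB sB by (simp add: seq_sum_union minimal_zero_sum_def seq_sum_add_mset m_comm)
  have "seq_sum G T \<noteq> \<one>" if T: "T \<subset># S + ?B" "T \<noteq> {#}" for T
  proof
    assume T0: "seq_sum G T = \<one>"
    define T1 where "T1 = T \<inter># S"
    define T2 where "T2 = T - S"
    have TT: "T = T1 + T2" by (rule multiset_eqI) (simp add: T1_def T2_def)
    have T1: "T1 \<subseteq># S" by (simp add: T1_def)
    have T2: "T2 \<subseteq># ?B" using T(1)
      by (simp add: T2_def subset_eq_diff_conv add.commute subset_mset.less_imp_le)
    have c1: "set_mset T1 \<subseteq> H" using T1 S(2) set_mset_mono[OF T1] by auto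
    have i2: "set_mset T2 \<subseteq> (\<lambda>h. e \<otimes> h) ` H" using set_mset_mono[OF T2] A by auto
    then obtain h where h: "h \<in> H" "seq_sum G T2 = e [^] size T2 \<otimes> h"
      using sum_mod by blast
    have c2: "set_mset T2 \<subseteq> carrier G" using set_mset_mono[OF T2] cB by auto
    have s1: "seq_sum G T1 \<in> H" using seq_sum_in_subgroup[OF H c1] .
    have s1c: "seq_sum G T1 \<in> carrier G" and hc: "h \<in> carrier G" using s1 h HG by auto
    have eq: "seq_sum G T1 \<otimes> (e [^] size T2 \<otimes> h) = \<one>"
      using T0 TT h seq_sum_union[OF _ c2, of T1] c1 HG by auto
    then have "e [^] size T2 \<otimes> (seq_sum G T1 \<otimes> h) = \<one>"
      using s1c hc e by (simp add: m_ac)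
    then have "inv (seq_sum G T1 \<otimes> h) = e [^] size T2"
      using s1c hc e by (intro inv_equality) auto
    moreover have "inv (seq_sum G T1 \<otimes> h) \<in> H"
      using s1 h H by (simp add: subgroup.m_closed subgroup.m_inv_closed)
    ultimately have "e [^] size T2 \<in> H" by simp
    then have "m dvd size T2" by (rule ind)
    moreover have "size T2 \<le> m" using size_mset_mono[OF T2] A by simp
    ultimately consider "size T2 = 0" | "size T2 = m" using m
      by (metis dvd_imp_le gr0I le_antisym)
    then show False
    proof cases
      case 1
      then have "T \<subset># add_mset g S"
        using TT T1 subset_mset.le_less_trans[OF T1 multi_psub_of_add_self] by simp
      then show False using S(1) T T0 by (auto simp: minimal_zero_sum_def)
    next
      case 2
      then have B: "T2 = ?B" using T2 A
        by (auto simp: subset_mset.le_less dest: mset_subset_size)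
      then have "T1 \<noteq> S" using T TT by auto
      then have "add_mset g T1 \<subset># add_mset g S" using T1 by (simp add: subset_mset.less_le)
      moreover have "seq_sum G (add_mset g T1) = \<one>"
        using eq h B sB c1 HG cS s1c by (subst seq_sum_add_mset) (auto simp: m_comm)
      ultimately show False using S(1) by (auto simp: minimal_zero_sum_def)
    qed
  qed
  then show ?thesis
    using zero cS cB A m unfolding minimal_zero_sum_def by auto
qed

section \<open>Sets of group elements with a prescribed sum\<close>

lemma seq_sum_translate_set:
  assumes "e \<in> carrier G" "finite A" "A \<subseteq> carrier G"
  shows "seq_sum G (mset_set ((\<lambda>h. e \<otimes> h) ` A)) = e [^] card A \<otimes> seq_sum G (mset_set A)"
proof -
  have "inj_on (\<lambda>h. e \<otimes> h) A" using assms by (auto simp: inj_on_def subsetD)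
  then have "mset_set ((\<lambda>h. e \<otimes> h) ` A) = image_mset (\<lambda>h. e \<otimes> h) (mset_set A)"
    by (simp add: image_mset_mset_set)
  then show ?thesis using seq_sum_translate[of e "mset_set A"] assms by simp
qed

lemma card_translate:
  assumes "e \<in> carrier G" "A \<subseteq> carrier G"
  shows "card ((\<lambda>h. e \<otimes> h) ` A) = card A"
  using assms by (intro card_image) (auto simp: inj_on_def subsetD)

text \<open>
  Cosets of \<open>C\<close> are added one at a time, always leaving out the coset of \<open>g\<close>. The sum over a coset
  \<open>h \<otimes> c\<close>, \<open>c \<in> C\<close>, is \<open>h [^] card C\<close> times the sum over \<open>C\<close>, which is why the exponent condition is
  needed as soon as a coset other than \<open>C\<close> itself occurs.
\<close>

lemma union_of_cosets:
  assumes H: "subgroup H G" "finite H" and C: "subgroup C G" "C \<subseteq> H"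
    and g: "g \<in> H" "g \<notin> C" and q: "0 < q" "card C * q < card H"
    and kill: "q = 1 \<or> (\<forall>h\<in>H. h [^] card C = \<one>)"
  shows "\<exists>A. C \<subseteq> A \<and> A \<subseteq> H \<and> card A = card C * q \<and> (\<forall>a\<in>A. \<forall>c\<in>C. a \<otimes> c \<in> A)
           \<and> g \<notin> A \<and> seq_sum G (mset_set A) \<in> C"
  using q kill
proof (induction q rule: nat_induct_non_zero)
  case 1
  have "finite C" using C H by (auto intro: finite_subset)
  then have "seq_sum G (mset_set C) \<in> C" using seq_sum_in_subgroup[OF C(1)] by simp
  then show ?case using C g by (intro exI[of _ C]) (auto simp: subgroup.m_closed)
next
  case (Suc q)
  have HG: "H \<subseteq> carrier G" and CG: "C \<subseteq> carrier G"
    using H C by (auto dest: subgroup.subset)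
  have finC: "finite C" using C H by (auto intro: finite_subset)
  have kill: "\<forall>h\<in>H. h [^] card C = \<one>" using Suc by auto
  have "card C * q < card H" using Suc.prems(1) by (rule le_less_trans[rotated]) simp
  then obtain A where A: "C \<subseteq> A" "A \<subseteq> H" "card A = card C * q" "\<forall>a\<in>A. \<forall>c\<in>C. a \<otimes> c \<in> A"
      "g \<notin> A" "seq_sum G (mset_set A) \<in> C"
    using Suc kill by blast
  have finA: "finite A" using A H by (auto intro: finite_subset)
  let ?gC = "(\<lambda>c. g \<otimes> c) ` C"
  have "card (A \<union> ?gC) \<le> card A + card ?gC" by (rule card_Un_le)
  also have "card ?gC = card C" using g HG CG by (intro card_translate) auto
  finally have "card (A \<union> ?gC) < card H" using A(3) Suc.prems(1) by simp
  then have "\<not> H \<subseteq> A \<union> ?gC" using card_mono[of "A \<union> ?gC" H] finA finC by fastforce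
  then obtain h where h: "h \<in> H" "h \<notin> A" "h \<notin> ?gC" by auto
  let ?hC = "(\<lambda>c. h \<otimes> c) ` C"
  have hc: "h \<in> carrier G" "g \<in> carrier G" using h g HG by auto
  \<comment> \<open>The coset of \<open>h\<close> is new: it meets neither the \<open>C\<close>-stable set \<open>A\<close> nor the coset of \<open>g\<close>.\<close>
  have coset_cancel: "y = h \<otimes> c \<Longrightarrow> h = y \<otimes> inv c" if "c \<in> C" for y c
    using that hc CG by (auto simp: m_assoc subsetD)
  have invC: "inv c \<in> C" if "c \<in> C" for c using C that by (simp add: subgroup.m_inv_closed)
  have disj: "A \<inter> ?hC = {}"
  proof (rule ccontr)
    assume "A \<inter> ?hC \<noteq> {}"
    then obtain c where "c \<in> C" "h \<otimes> c \<in> A" by auto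
    then have "h \<otimes> c \<otimes> inv c \<in> A" using A(4) invC by blast
    then show False using h(2) coset_cancel[OF \<open>c \<in> C\<close> refl] by simp
  qed
  have gn: "g \<notin> ?hC"
  proof
    assume "g \<in> ?hC"
    then obtain c where "c \<in> C" "g = h \<otimes> c" by auto
    then show False using h(3) coset_cancel[of c g] invC[of c] by auto
  qed
  have "card (A \<union> ?hC) = card C * Suc q"
    using finA finC disj A(3) hc CG by (simp add: card_Un_disjoint card_translate)
  moreover have "A \<union> ?hC \<subseteq> H" using A h C H by (auto intro: subgroup.m_closed)
  moreover have "\<forall>a\<in>A \<union> ?hC. \<forall>c\<in>C. a \<otimes> c \<in> A \<union> ?hC"
    using A(4) C hc CG by (auto simp: m_assoc subsetD subgroup.m_closed)
  moreover have "seq_sum G (mset_set (A \<union> ?hC)) \<in> C"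
  proof -
    have "seq_sum G (mset_set ?hC) = seq_sum G (mset_set C)"
      using seq_sum_translate_set[of h C] hc finC CG kill h by simp
    also have "\<dots> \<in> C" using seq_sum_in_subgroup[OF C(1)] finC by simp
    finally have "seq_sum G (mset_set ?hC) \<in> C" .
    moreover have "?hC \<subseteq> carrier G" using hc CG by auto
    then have "seq_sum G (mset_set (A \<union> ?hC)) = seq_sum G (mset_set A) \<otimes> seq_sum G (mset_set ?hC)"
      using finA finC disj A HG by (subst mset_set_Union) (auto intro!: seq_sum_union)
    ultimately show ?thesis using A C by (simp add: subgroup.m_closed)
  qed
  ultimately show ?case using A gn by (intro exI[of _ "A \<union> ?hC"]) auto
qed

text \<open>
  A union \<open>A\<close> of cosets of \<open>C\<close> whose sum \<open>s\<close> lies in \<open>C\<close> needs only one correction: \<open>\<one> \<in> A\<close> is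
  exchanged for \<open>d = g \<otimes> inv s\<close>, which makes the sum \<open>g\<close>. The element \<open>d\<close> lies in the coset of \<open>g\<close>,
  which \<open>A\<close> avoids, so no element is repeated.
\<close>

lemma subset_with_sum:
  assumes H: "subgroup H G" "finite H" and C: "subgroup C G" "C \<subseteq> H"
    and g: "g \<in> H" "g \<notin> C" and m: "card C dvd m" "0 < m" "m < card H"
    and kill: "m = card C \<or> (\<forall>h\<in>H. h [^] card C = \<one>)"
  obtains A where "A \<subseteq> H" "card A = m" "seq_sum G (mset_set A) = g"
proof -
  obtain q where q: "m = card C * q" using m by auto
  have "0 < q" using q m by (cases q) auto
  moreover have "q = 1 \<or> (\<forall>h\<in>H. h [^] card C = \<one>)" using kill q m by auto
  ultimately obtain A where A: "C \<subseteq> A" "A \<subseteq> H" "card A = m" "\<forall>a\<in>A. \<forall>c\<in>C. a \<otimes> c \<in> A"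
      "g \<notin> A" "seq_sum G (mset_set A) \<in> C"
    using union_of_cosets[OF H C g] q m by metis
  have HG: "H \<subseteq> carrier G" using H by (auto dest: subgroup.subset)
  have finA: "finite A" using A H by (auto intro: finite_subset)
  let ?s = "seq_sum G (mset_set A)"
  have oneA: "\<one> \<in> A" using A C by (auto simp: subgroup.one_closed)
  have sc: "?s \<in> H" "?s \<in> carrier G" and gc: "g \<in> carrier G" using A C g HG by auto
  define d where "d = g \<otimes> inv ?s"
  have dH: "d \<in> H" unfolding d_def using g sc H by (simp add: subgroup.m_closed subgroup.m_inv_closed)
  have dc: "d \<in> carrier G" using dH HG by auto
  have gd: "g = d \<otimes> ?s" unfolding d_def using gc sc by (simp add: m_assoc)
  have dA: "d \<notin> A" using A gd by auto
  have A1: "mset_set A = add_mset \<one> (mset_set (A - {\<one>}))"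
    using finA oneA by (simp add: mset_set.remove)
  have c1: "set_mset (mset_set (A - {\<one>})) \<subseteq> carrier G" using finA A HG by auto
  have "seq_sum G (mset_set (A - {\<one>})) = ?s"
    unfolding A1 using c1 by (subst seq_sum_add_mset) auto
  then have "seq_sum G (mset_set (insert d (A - {\<one>}))) = g"
    using gd finA dA dc c1 by (simp add: seq_sum_add_mset)
  moreover have "card (insert d (A - {\<one>})) = m"
    using finA dA oneA A(3) m by (simp add: card_Diff_singleton)
  moreover have "insert d (A - {\<one>}) \<subseteq> H" using A(2) dH by auto
  ultimately show ?thesis using that by blast
qed

end

section \<open>Sequences over a cyclic group\<close>

text \<open>
  The smallest sum of \<open>f\<close> distinct positive integers is \<open>1 + \<dots> + f\<close>. Any larger number is
  reached by enlarging the last summand.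
\<close>

lemma distinct_summands:
  fixes f N :: nat
  assumes "f * (f + 1) \<le> 2 * N" "0 < N \<Longrightarrow> 0 < f"
  obtains J where "finite J" "card J = f" "\<Sum>J = N" "0 \<notin> J"
proof (cases "f = 0")
  case True
  then show ?thesis using assms that[of "{}"] by (cases "N = 0") auto
next
  case False
  define b where "b = N - \<Sum>{1..<f}"
  have "2 * \<Sum>{1..<f} + f = f * f" by (induction f) auto
  then have "\<Sum>{1..<f} + f \<le> N" using assms(1) by (simp add: algebra_simps)
  then have "f \<le> b" "\<Sum>{1..<f} + b = N" by (auto simp: b_def)
  then show ?thesis using False
    by (intro that[of "insert b {1..<f}"]) auto
qed

context comm_group
begin

text \<open>
  The exponents of a proper non-empty subsequence add up to a number strictly between \<open>0\<close> and the
  order of \<open>e\<close>.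
\<close>

lemma minimal_zero_sum_powers:
  assumes e: "e \<in> carrier G" "0 < ord e" and M: "0 \<notin># M" "sum_mset M = ord e"
  shows "minimal_zero_sum G (image_mset (\<lambda>a. e [^] a) M)"
proof -
  have "seq_sum G T \<noteq> \<one>" if T: "T \<subset># image_mset (\<lambda>a. e [^] a) M" "T \<noteq> {#}" for T
  proof -
    obtain R where "image_mset (\<lambda>a. e [^] a) M = T + R"
      using T(1) by (metis subset_mset.add_diff_inverse subset_mset.less_imp_le)
    then obtain M' M'' where M': "M = M' + M''" "T = image_mset (\<lambda>a. e [^] a) M'"
      by (auto dest!: image_mset_eq_plusD)
    have pos: "sum_mset X \<noteq> 0" if X: "0 \<notin># X" "X \<noteq> {#}" for X :: "nat multiset"
    proof -
      obtain x where "x \<in># X" using X(2) by (rule multiset_nonemptyE)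
      then show ?thesis using X(1) by (auto intro!: bexI[of _ x] intro: gr0I)
    qed
    have "M'' \<noteq> {#}" using T M' by auto
    then have "sum_mset M' \<noteq> 0" "sum_mset M'' \<noteq> 0"
      using M(1) M' T(2) pos[of M'] pos[of M''] by auto
    then have "0 < sum_mset M'" "sum_mset M' < ord e"
      using M(2) unfolding M'(1) sum_mset.union by linarith+
    then have "\<not> ord e dvd sum_mset M'" by (simp add: nat_dvd_not_less)
    then show ?thesis using e by (simp add: M' seq_sum_powers pow_eq_id)
  qed
  moreover have "M \<noteq> {#}" using M e by auto
  ultimately show ?thesis
    using e M by (auto simp: minimal_zero_sum_def seq_sum_powers pow_eq_id)
qed

lemma generate_singleton_nat_pow:
  assumes "finite (carrier G)" "x \<in> carrier G" "y \<in> generate G {x}"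
  obtains j :: nat where "y = x [^] j"
proof -
  obtain k :: int where k: "y = x [^] k" using assms generate_pow by auto
  have o: "0 < ord x" using ord_ge_1[OF assms(1,2)] by simp
  define j where "j = nat (k mod int (ord x))"
  have j: "int j = k mod int (ord x)" using o by (simp add: j_def)
  have "int (ord x) dvd int j - k" unfolding j by (simp add: mod_eq_dvd_iff[symmetric])
  then have "x [^] k = x [^] int j" using assms(2) by (simp add: int_pow_eq)
  then show ?thesis using that[of j] k by (simp add: int_pow_int)
qed

lemma cyclic_subgroup_of_order:
  assumes "finite (carrier G)" "x \<in> carrier G" "0 < m" "m dvd ord x"
  obtains C where "subgroup C G" "C \<subseteq> generate G {x}" "card C = m"
proof -
  obtain q where q: "ord x = m * q" using assms(4) by auto
  have "0 < ord x" using ord_ge_1[OF assms(1,2)] by simp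
  then have q0: "q \<noteq> 0" using q by (cases q) auto
  have y: "x [^] q \<in> carrier G" using assms by simp
  have "ord (x [^] q) = m" using ord_pow[OF assms(2), of q] q q0 by simp
  then have "card (generate G {x [^] q}) = m" using generate_pow_card[OF y] by simp
  moreover have sub: "subgroup (generate G {x}) G" using assms by (simp add: generate_is_subgroup)
  have "x [^] q \<in> generate G {x}"
    using generate_pow[OF assms(2)] int_pow_int[of G x q] by (auto intro!: exI[of _ "int q"])
  then have "generate G {x [^] q} \<subseteq> generate G {x}"
    using generate_subgroup_incl[OF _ sub, of "{x [^] q}"] by simp
  ultimately show ?thesis using that[of "generate G {x [^] q}"] y by (simp add: generate_is_subgroup)
qed

end

section \<open>Independent families\<close>

text \<open>
  Independence is stated through generated subgroups: modulo the subgroup generated by some of the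
  elements, each of the others keeps its order \<open>n s\<close>. This is what the exchange of a term against
  terms of a coset needs.
\<close>

locale independent_family = comm_group G for G (structure) +
  fixes e :: "nat \<Rightarrow> 'a" and n :: "nat \<Rightarrow> nat" and r :: nat
  assumes finite_carrier: "finite (carrier G)"
    and e_closed: "i \<in> {1..r} \<Longrightarrow> e i \<in> carrier G"
    and e_pow: "i \<in> {1..r} \<Longrightarrow> e i [^] n i = \<one>"
    and independent: "s \<in> {1..r} \<Longrightarrow> I \<subseteq> {1..r} - {s} \<Longrightarrow> e s [^] j \<in> generate G (e ` I) \<Longrightarrow> n s dvd (j::nat)"
    and n_gt_1: "i \<in> {1..r} \<Longrightarrow> 1 < n i"
    and n_dvd: "1 \<le> i \<Longrightarrow> i \<le> j \<Longrightarrow> j \<le> r \<Longrightarrow> n i dvd n j"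
begin

abbreviation span :: "nat set \<Rightarrow> 'a set" where
  "span I \<equiv> generate G (e ` I)"

lemma subgroup_span: "I \<subseteq> {1..r} \<Longrightarrow> subgroup (span I) G"
  using e_closed by (intro generate_is_subgroup) auto

lemma span_carrier: "I \<subseteq> {1..r} \<Longrightarrow> span I \<subseteq> carrier G"
  using subgroup_span by (rule subgroup.subset)

lemma finite_span: "I \<subseteq> {1..r} \<Longrightarrow> finite (span I)"
  using span_carrier finite_carrier by (rule finite_subset)

lemma e_in_span: "i \<in> I \<Longrightarrow> e i \<in> span I"
  by (simp add: generate.incl)

lemma ord_e: "i \<in> {1..r} \<Longrightarrow> ord (e i) = n i"
proof (rule dvd_antisym)
  assume i: "i \<in> {1..r}"
  show "ord (e i) dvd n i" using e_pow[OF i] e_closed[OF i] pow_eq_id by auto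
  have "e i [^] ord (e i) \<in> span {}" using e_closed[OF i] by (simp add: generate.one)
  then show "n i dvd ord (e i)" using independent[OF i, of "{}" "ord (e i)"] by simp
qed

lemma e_notin_span: "s \<in> {1..r} \<Longrightarrow> I \<subseteq> {1..r} - {s} \<Longrightarrow> e s \<notin> span I"
  using independent[of s I 1] n_gt_1[of s] e_closed[of s] by auto

text \<open>
  The bound makes room for \<open>n s\<close> distinct elements with a prescribed sum. It is obtained by writing
  elements as \<open>e s [^] j \<otimes> h\<close>, which is unique for \<open>j < n s\<close> by independence.
\<close>

lemma card_span_ge:
  assumes "I \<subseteq> {1..r}"
  shows "(\<Prod>i\<in>I. n i) \<le> card (span I)"
proof -
  have "finite I" using assms finite_subset by blast
  then show ?thesis using assms
  proof (induction I)
    case empty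
    then show ?case by (simp add: generate_empty)
  next
    case (insert s I)
    then have sI: "s \<in> {1..r}" "I \<subseteq> {1..r} - {s}" "I \<subseteq> {1..r}" by auto
    let ?f = "\<lambda>(j, h). e s [^] (j::nat) \<otimes> h"
    have sub: "subgroup (span I) G" using sI by (intro subgroup_span)
    have sub': "subgroup (span (insert s I)) G" using insert by (intro subgroup_span) auto
    have es: "e s \<in> carrier G" using e_closed sI by auto
    have step: "j = j' \<and> h = h'"
      if jh: "j \<le> j'" "j' < n s" "h \<in> span I" "h' \<in> span I" "e s [^] j \<otimes> h = e s [^] j' \<otimes> h'"
      for j j' :: nat and h h'
    proof -
      have c: "h \<in> carrier G" "h' \<in> carrier G" using jh span_carrier[OF sI(3)] by auto
      have "e s [^] j' = e s [^] j \<otimes> e s [^] (j' - j)" using jh es by (simp add: nat_pow_mult)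
      then have "h = e s [^] (j' - j) \<otimes> h'" using jh(5) c es by (simp add: m_assoc)
      then have "e s [^] (j' - j) = h \<otimes> inv h'" using c es by (simp add: m_assoc)
      then have "e s [^] (j' - j) \<in> span I"
        using jh sub by (simp add: subgroup.m_closed subgroup.m_inv_closed)
      then have "n s dvd j' - j" using sI by (intro independent)
      then have "j = j'" using jh by (auto dest: dvd_imp_le)
      then show ?thesis using jh c es by simp
    qed
    have inj: "inj_on ?f ({..<n s} \<times> span I)"
    proof (rule inj_onI, clarsimp)
      fix j h j' h' assume "j < n s" "j' < n s" "h \<in> span I" "h' \<in> span I"
        "e s [^] j \<otimes> h = e s [^] j' \<otimes> h'"
      then show "j = j' \<and> h = h'" using step[of j j' h h'] step[of j' j h' h] by (metis linear)
    qed
    have "e s [^] j \<otimes> h \<in> span (insert s I)" if "h \<in> span I" for j :: nat and h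
    proof -
      have "h \<in> span (insert s I)" using that mono_generate[of "e ` I" "e ` insert s I"] by auto
      moreover have "e s [^] j \<in> span (insert s I)"
        using sub' e_in_span[of s "insert s I"]
        by (induction j) (auto simp: subgroup.one_closed subgroup.m_closed)
      ultimately show ?thesis using sub' by (simp add: subgroup.m_closed)
    qed
    then have "?f ` ({..<n s} \<times> span I) \<subseteq> span (insert s I)" by auto
    then have "card (?f ` ({..<n s} \<times> span I)) \<le> card (span (insert s I))"

      using finite_span[of "insert s I"] insert.prems by (intro card_mono)
    then have "n s * card (span I) \<le> card (span (insert s I))"
      using inj by (simp add: card_image card_cartesian_product)
    moreover have "n s * (\<Prod>i\<in>I. n i) \<le> n s * card (span I)" using insert by simp
    ultimately have "n s * (\<Prod>i\<in>I. n i) \<le> card (span (insert s I))" by linarith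
    then show ?case using insert.hyps by simp
  qed
qed

lemma span_killed:
  assumes "I \<subseteq> {1..r}" "\<And>i. i \<in> I \<Longrightarrow> n i dvd q" "h \<in> span I"
  shows "h [^] q = \<one>"
proof -
  have "subgroup {x \<in> carrier G. x [^] q = \<one>} G"
    by (rule subgroupI) (auto simp: nat_pow_inv pow_mult_distrib[OF m_comm])
  moreover have "e ` I \<subseteq> {x \<in> carrier G. x [^] q = \<one>}"
    using assms e_closed ord_e by (auto simp: pow_eq_id subset_iff)
  ultimately have "span I \<subseteq> {x \<in> carrier G. x [^] q = \<one>}" by (rule generate_subgroup_incl[rotated])
  then show ?thesis using assms by auto
qed

lemma ord_e1_e:
  assumes u: "u \<in> {2..r}"
  shows "ord (e 1 \<otimes> e u) = n u"
proof (rule dvd_antisym)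
  have c: "e 1 \<in> carrier G" "e u \<in> carrier G" using u e_closed by auto
  have "e 1 [^] n u = \<one>" using u n_dvd[of 1 u] c ord_e[of 1] by (simp add: pow_eq_id)
  then have "(e 1 \<otimes> e u) [^] n u = \<one>"
    using c e_pow[of u] u by (simp add: pow_mult_distrib[OF m_comm])
  then show "ord (e 1 \<otimes> e u) dvd n u" using c by (simp add: pow_eq_id)
  define q where "q = ord (e 1 \<otimes> e u)"
  have "e 1 [^] q \<otimes> e u [^] q = \<one>"
    using c pow_ord_eq_1[of "e 1 \<otimes> e u"] pow_mult_distrib[OF m_comm[OF c] c, of q]
    by (simp add: q_def)
  then have "e u [^] q = inv (e 1 [^] q)" using c by (metis inv_equality m_comm nat_pow_closed)
  also have "\<dots> \<in> span {1}"
    using subgroup_span[of "{1}"] e_in_span[of 1 "{1}"] u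
    by (metis atLeastAtMost_iff empty_subsetI insert_subset le_trans one_le_numeral order_refl
        subgroup.m_inv_closed subgroup_int_pow_closed int_pow_int)
  finally show "n u dvd ord (e 1 \<otimes> e u)"
    unfolding q_def[symmetric] using u independent[of u "{1}" q] by auto
qed

text \<open>
  The repeated term that is exchanged will always be \<open>e t\<close>, so large cyclic subgroups without \<open>e t\<close>
  are wanted. The subgroup of \<open>e u\<close> will not do for \<open>u = t\<close>. Multiplying by \<open>e 1\<close> tilts it
  away from \<open>e t\<close> without changing its order: an exponent producing \<open>e t\<close> would be \<open>0\<close> modulo \<open>n 1\<close>,
  and \<open>1\<close> modulo \<open>n t\<close> and hence modulo \<open>n 1\<close>.
\<close>

lemma e_notin_generate_e1_e:
  assumes "2 \<le> t" "t \<le> u" "u \<le> r"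
  shows "e t \<notin> generate G {e 1 \<otimes> e u}"
proof
  have c: "e 1 \<in> carrier G" "e u \<in> carrier G" "e t \<in> carrier G" using assms e_closed by auto
  assume "e t \<in> generate G {e 1 \<otimes> e u}"
  then obtain j :: nat where "e t = (e 1 \<otimes> e u) [^] j"
    using generate_singleton_nat_pow finite_carrier c by (metis m_closed)
  then have j: "e t = e 1 [^] j \<otimes> e u [^] j" using c by (simp add: pow_mult_distrib[OF m_comm])
  have pw: "x [^] j \<in> K" if "subgroup K G" "x \<in> K" for x K
    using subgroup_int_pow_closed[OF that, of "int j"] by (simp add: int_pow_int)
  show False
  proof (cases "u = t")
    case False
    have K: "subgroup (span {1, u}) G" using assms by (intro subgroup_span) auto
    have "e t \<in> span {1, u}" unfolding j
      using K by (intro subgroup.m_closed[OF K] pw e_in_span) auto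
    then show False using e_notin_span[of t "{1,u}"] assms False by auto
  next
    case True
    have K: "subgroup (span {t}) G" using assms by (intro subgroup_span) auto
    have "e 1 [^] j = e t \<otimes> inv (e t [^] j)" using j c True by (metis inv_solve_right nat_pow_closed)
    also have "\<dots> \<in> span {t}"
      using K by (intro subgroup.m_closed[OF K] subgroup.m_inv_closed[OF K] pw e_in_span) auto
    finally have d: "n 1 dvd j" using assms by (intro independent[of 1 "{t}"]) auto
    then have "e 1 [^] j = \<one>" using c ord_e[of 1] assms by (simp add: pow_eq_id)
    then have "e t [^] (int j) = e t [^] (1::int)" using j c True by (simp add: int_pow_int)
    then have "int (n t) dvd 1 - int j"
      using int_pow_eq[OF c(3), of "int j" 1] ord_e[of t] assms by (metis atLeastAtMost_iff le_trans one_le_numeral)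
    moreover have "int (n 1) dvd int (n t)" using n_dvd[of 1 t] assms by simp
    ultimately have "int (n 1) dvd 1 - int j" by (rule dvd_trans[rotated])
    then have "int (n 1) dvd 1" using d by (metis dvd_diffD1 int_dvd_int_iff dvd_add_left_iff diff_add_cancel)
    then show False using n_gt_1[of 1] assms by auto
  qed
qed

end

section \<open>Extending a sequence by one basis element\<close>

lemma card_set_mset_eq_size:
  assumes "\<And>x. count S x \<le> 1"
  shows "card (set_mset S) = size S"
proof -
  have "S = mset_set (set_mset S)"
    using assms by (intro multiset_eqI) (metis count_eq_zero_iff count_mset_set(1,3) finite_set_mset le_antisym leI less_one)
  then show ?thesis by (metis size_mset_set)
qed

context independent_family
begin

text \<open>
  That the terms generate the whole subgroup is carried along for one purpose: such a sequence has a
  term outside any given proper subgroup, so a term to exchange can be found even when no term is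
  repeated.
\<close>

definition spanning :: "nat set \<Rightarrow> 'a multiset \<Rightarrow> bool" where
  "spanning I S \<longleftrightarrow> minimal_zero_sum G S \<and> generate G (set_mset S) = span I"

lemma spanning_in_span: "spanning I S \<Longrightarrow> set_mset S \<subseteq> span I"
  unfolding spanning_def by (metis generate.incl subsetI)

lemma span_mono: "I \<subseteq> J \<Longrightarrow> span I \<subseteq> span J"
  by (simp add: image_mono mono_generate)

text \<open>
  Generation survives an exchange: the removed term \<open>g\<close> is the inverse of the sum of the terms that
  stay, so the new terms still generate \<open>span I\<close>, and then \<open>e s\<close> can be split off any one of the
  terms in its coset.
\<close>

lemma spanning_replace:
  assumes I: "I \<subseteq> {1..r}" and s: "s \<in> {1..r} - I" and S: "spanning I (add_mset g S)"
    and A: "set_mset A \<subseteq> span I" "size A = n s" "seq_sum G A = g"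
  shows "spanning (insert s I) (S + image_mset (\<lambda>h. e s \<otimes> h) A)"
  unfolding spanning_def
proof
  have inS: "set_mset (add_mset g S) \<subseteq> span I" using S by (rule spanning_in_span)
  have Is: "I \<subseteq> {1..r} - {s}" using s I by auto
  have es: "e s \<in> carrier G" and ns: "1 < n s" using s e_closed n_gt_1 by auto
  have Sm: "minimal_zero_sum G (add_mset g S)" using S by (simp add: spanning_def)
  show "minimal_zero_sum G (S + image_mset (\<lambda>h. e s \<otimes> h) A)"
    using s ns e_pow[of s] independent[of s I] Is
    by (intro minimal_zero_sum_replace[OF subgroup_span[OF I] es, of "n s" g]) (use A Sm inS in auto)
  let ?X = "set_mset (S + image_mset (\<lambda>h. e s \<otimes> h) A)"
  let ?K = "generate G ?X"
  have sI: "insert s I \<subseteq> {1..r}" using s I by auto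
  have H: "subgroup (span (insert s I)) G" using sI by (rule subgroup_span)
  have up: "span I \<subseteq> span (insert s I)" by (rule span_mono) auto
  have "e s \<otimes> a \<in> span (insert s I)" if "a \<in> span I" for a
    using that up by (intro subgroup.m_closed[OF H] e_in_span) auto
  then have X: "?X \<subseteq> span (insert s I)" using inS A(1) up by auto
  have K: "subgroup ?K G" using X span_carrier[OF sI] by (intro generate_is_subgroup) auto
  have SK: "set_mset S \<subseteq> ?K" by (auto intro: generate.incl)
  have gc: "g \<in> carrier G" "set_mset S \<subseteq> carrier G" using inS span_carrier[OF I] by auto
  have "g \<otimes> seq_sum G S = \<one>"
    using Sm gc by (simp add: minimal_zero_sum_def seq_sum_add_mset)
  then have "inv (seq_sum G S) = g" using gc by (intro inv_equality) auto
  then have "g \<in> ?K" using K SK seq_sum_in_subgroup by (metis subgroup.m_inv_closed)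
  then have "span I \<subseteq> ?K"
    using S SK generate_subgroup_incl[OF _ K, of "set_mset (add_mset g S)"] by (simp add: spanning_def)
  moreover have "e s \<in> ?K"
  proof -
    obtain a where a: "a \<in># A" using A ns by (metis multiset_nonemptyE not_one_less_zero size_empty)
    then have "a \<in> ?K" "a \<in> carrier G" using A \<open>span I \<subseteq> ?K\<close> span_carrier[OF I] by auto
    moreover have "e s \<otimes> a \<in> ?K" using a by (intro generate.incl) auto
    ultimately have "e s \<otimes> a \<otimes> inv a \<in> ?K"
      using K by (simp add: subgroup.m_closed subgroup.m_inv_closed)
    then show ?thesis using es \<open>a \<in> carrier G\<close> by (simp add: m_assoc)
  qed
  moreover have "e ` I \<subseteq> span I" using e_in_span by auto
  ultimately have "span (insert s I) \<subseteq> ?K" using K by (intro generate_subgroup_incl) auto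
  moreover have "?K \<subseteq> span (insert s I)" using X H by (intro generate_subgroup_incl)
  ultimately show "?K = span (insert s I)" by simp
qed

lemma translate_notin_span:
  assumes "I \<subseteq> {1..r}" "s \<in> {1..r} - I" "h \<in> span I"
  shows "e s \<otimes> h \<notin> span I"
proof
  assume "e s \<otimes> h \<in> span I"
  then have "e s \<otimes> h \<otimes> inv h \<in> span I"
    using assms subgroup_span[of I] by (simp add: subgroup.m_closed subgroup.m_inv_closed)
  moreover have "h \<in> carrier G" "e s \<in> carrier G" using assms span_carrier e_closed by auto
  ultimately have "e s \<in> span I" by (simp add: m_assoc)
  then show False using e_notin_span[of s I] assms by auto
qed

text \<open>
  The new terms can be taken distinct as soon as \<open>g\<close> avoids the cyclic subgroup of a suitable \<open>x\<close>.
  If \<open>n s\<close> divides the order of \<open>x\<close>, a single subgroup of order \<open>n s\<close> provides enough elements;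
  otherwise \<open>n s\<close> elements are collected from several cosets of the subgroup of \<open>x\<close>.
\<close>

lemma spanning_replace_distinct:
  assumes I: "I \<subseteq> {1..r}" and s: "s \<in> {1..r} - I" and S: "spanning I (add_mset g S)"
    and x: "x \<in> span I" "g \<notin> generate G {x}" and small: "n s < card (span I)"
    and ord: "n s dvd ord x \<or> ord x dvd n s \<and> (\<forall>i\<in>I. n i dvd ord x)"
  obtains B where "finite B" "card B = n s" "B \<inter> span I = {}" "spanning (insert s I) (S + mset_set B)"
proof -
  have xc: "x \<in> carrier G" using x span_carrier[OF I] by auto
  have ns: "0 < n s" using s n_gt_1[of s] by auto
  have gH: "g \<in> span I" using spanning_in_span[OF S] by simp
  have xI: "generate G {x} \<subseteq> span I"
    using x subgroup_span[OF I] by (intro generate_subgroup_incl) auto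
  obtain C where C: "subgroup C G" "C \<subseteq> generate G {x}" "card C dvd n s"
    "n s = card C \<or> (\<forall>h\<in>span I. h [^] card C = \<one>)"
    using ord
  proof
    assume "n s dvd ord x"
    then obtain C where "subgroup C G" "C \<subseteq> generate G {x}" "card C = n s"
      using cyclic_subgroup_of_order finite_carrier xc ns by blast
    then show ?thesis using that by auto
  next
    assume "ord x dvd n s \<and> (\<forall>i\<in>I. n i dvd ord x)"
    then show ?thesis
      using that[of "generate G {x}"] generate_pow_card[OF xc] span_killed[OF I] xc
      by (auto simp: generate_is_subgroup)
  qed
  then have "C \<subseteq> span I" "g \<notin> C" using xI x by auto
  then obtain A where A: "A \<subseteq> span I" "card A = n s" "seq_sum G (mset_set A) = g"
    using subset_with_sum[OF subgroup_span[OF I] finite_span[OF I] C(1) _ gH _ C(3) ns small C(4)] by auto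
  have finA: "finite A" using A(1) finite_span[OF I] by (rule finite_subset)
  let ?B = "(\<lambda>h. e s \<otimes> h) ` A"
  have es: "e s \<in> carrier G" and Ac: "A \<subseteq> carrier G" using s e_closed A span_carrier[OF I] by auto
  have "inj_on (\<lambda>h. e s \<otimes> h) A" using es Ac by (auto simp: inj_on_def subsetD)
  then have "mset_set ?B = image_mset (\<lambda>h. e s \<otimes> h) (mset_set A)" by (simp add: image_mset_mset_set)
  then have "spanning (insert s I) (S + mset_set ?B)"
    using spanning_replace[OF I s S, of "mset_set A"] A finA by simp
  moreover have "?B \<inter> span I = {}" using translate_notin_span[OF I s] A by auto
  ultimately show ?thesis using that[of ?B] finA A card_translate[OF es Ac] by simp
qed

text \<open>
  The budget \<open>c\<close> bounds the cumulated multiplicity. The only term that may be repeated is \<open>e t\<close>, so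
  that one choice of \<open>x\<close> per extension deals with every possible repetition.
\<close>

definition attains :: "nat \<Rightarrow> nat set \<Rightarrow> nat \<Rightarrow> nat \<Rightarrow> bool" where
  "attains t I l c \<longleftrightarrow> (\<exists>S. spanning I S \<and> size S = l \<and> l \<le> card (set_mset S) + c
      \<and> (\<forall>y. 2 \<le> count S y \<longrightarrow> y = e t))"

text \<open>
  Each extension lowers the cumulated multiplicity by one as long as it is positive: a repeated term
  is then used up. When all terms are distinct, any term outside the cyclic subgroup of \<open>x\<close> serves.
\<close>

lemma attains_extend:
  assumes I: "I \<subseteq> {1..r}" "t \<in> I" and s: "s \<in> {1..r} - I" and a: "attains t I l c"
    and x: "x \<in> span I" "e t \<notin> generate G {x}" and small: "n s < card (span I)"
    and ord: "n s dvd ord x \<or> ord x dvd n s \<and> (\<forall>i\<in>I. n i dvd ord x)"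
  shows "attains t (insert s I) (l + (n s - 1)) (c - 1)"
proof -
  obtain S where S: "spanning I S" "size S = l" "l \<le> card (set_mset S) + c"
    and rep: "\<And>y. 2 \<le> count S y \<Longrightarrow> y = e t"
    using a unfolding attains_def by blast
  have ns: "1 < n s" using s n_gt_1 by auto
  have xc: "x \<in> carrier G" using x span_carrier[OF I(1)] by auto
  obtain g S0 where g: "S = add_mset g S0" "g \<notin> generate G {x}"
    and S0: "size S0 \<le> card (set_mset S0) + (c - 1)"
  proof (cases "2 \<le> count S (e t)")
    case True
    then obtain S0 where S0: "S = add_mset (e t) S0"
      by (metis count_eq_zero_iff mset_add not_numeral_le_zero)
    then have "e t \<in># S0" using True by (auto simp: not_in_iff)
    then have "set_mset S = set_mset S0" using S0 by auto
    then show ?thesis using that S0 x S by auto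
  next
    case False
    then have "\<And>y. count S y \<le> 1" using rep by (metis Suc_1 not_less_eq_eq One_nat_def)
    moreover have "\<not> set_mset S \<subseteq> generate G {x}"
    proof
      assume "set_mset S \<subseteq> generate G {x}"
      then have "generate G (set_mset S) \<subseteq> generate G {x}"
        using xc by (intro generate_subgroup_incl generate_is_subgroup) auto
      then show False using S(1) x(2) e_in_span[OF I(2)] by (auto simp: spanning_def)
    qed
    then obtain g where "g \<in># S" "g \<notin> generate G {x}" by auto
    moreover from this obtain S0 where S0: "S = add_mset g S0" by (metis mset_add)
    moreover have "count S0 y \<le> 1" for y using calculation(1)[of y] S0 by (auto split: if_splits)
    ultimately show ?thesis using that card_set_mset_eq_size[of S0] by auto
  qed
  obtain B where B: "finite B" "card B = n s" "B \<inter> span I = {}" "spanning (insert s I) (S0 + mset_set B)"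
    using spanning_replace_distinct[OF I(1) s _ x(1) g(2) small ord] S(1) g(1) by auto
  have disj: "set_mset S0 \<inter> B = {}" using spanning_in_span[OF S(1)] g(1) B by auto
  have "card (set_mset S0 \<union> B) = card (set_mset S0) + n s"
    using B disj by (simp add: card_Un_disjoint)
  moreover have "y = e t" if "2 \<le> count (S0 + mset_set B) y" for y
  proof -
    have "2 \<le> count S0 y"
      using that disj B(1) by (cases "y \<in> B") (auto simp: not_in_iff disjoint_iff)
    moreover have "count S0 y \<le> count S y" by (simp add: g(1))
    ultimately show ?thesis by (intro rep) simp
  qed
  ultimately show ?thesis unfolding attains_def
    using B S0 S(2) g(1) ns by (intro exI[of _ "S0 + mset_set B"]) auto
qed

text \<open>
  The sequence over the subgroup of \<open>e t\<close> consists of the powers with exponents in \<open>J\<close> and of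
  \<open>n t - \<Sum>J\<close> further copies of \<open>e t\<close>. The extension by \<open>e 1\<close> needs \<open>n 1\<close> elements of the subgroup
  of \<open>e t\<close> with sum \<open>e t\<close>, which cannot be distinct in general: for \<open>n 1 = n t\<close> all elements would be
  used, and their sum is fixed. So \<open>n 1 - 1\<close> of them are taken distinct, and the last one \<open>w\<close> is
  determined by the sum and possibly a repetition. The term \<open>e 1 \<otimes> w\<close> arising from it is the one
  exchanged in the extension by \<open>e p\<close>, and no repetition is left but that of \<open>e t\<close>. Of the two
  extensions only the first uses up a copy of \<open>e t\<close>.
\<close>

lemma attains_initial:
  assumes t: "t \<in> {2..r}" and p: "p \<in> {2..r} - {t}"
    and J: "finite J" "0 \<notin> J" "\<Sum>J < n t"
    and np: "n p dvd n t \<or> n t dvd n p" "n p < n 1 * n t"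
  shows "attains t {1, p, t} (n t - \<Sum>J + card J + (n 1 - 1) + (n p - 1)) (n t - \<Sum>J - 1)"
proof -
  let ?N = "\<Sum>J"
  have et: "e t \<in> carrier G" and e1: "e 1 \<in> carrier G" using t e_closed by auto
  have ot: "ord (e t) = n t" using t ord_e by auto
  have n1: "1 < n 1" "1 < n p" "1 < n t" using t p n_gt_1 by auto
  have n1t: "n 1 \<le> n t" using t n_dvd[of 1 t] n1 by (intro dvd_imp_le) auto
  define M0 where "M0 = replicate_mset (n t - ?N - 1) (1::nat) + mset_set J"
  define T where "T = image_mset (\<lambda>a. e t [^] a) M0"
  have sumM: "sum_mset (add_mset 1 M0) = n t"
    using J by (simp add: M0_def sum_unfold_sum_mset)
  have tr: "{t} \<subseteq> {1..r}" "1 \<in> {1..r} - {t}" using t by auto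
  have sub: "subgroup (span {t}) G" using tr by (intro subgroup_span)
  have pw: "e t [^] a \<in> span {t}" for a :: nat
    using sub e_in_span[of t "{t}"] by (induction a) (auto simp: subgroup.one_closed subgroup.m_closed)
  have T: "spanning {t} (add_mset (e t) T)"
    unfolding spanning_def
  proof
    have "minimal_zero_sum G (image_mset (\<lambda>a. e t [^] a) (add_mset 1 M0))"
      using et ot J n1 sumM by (intro minimal_zero_sum_powers) (auto simp: M0_def)
    then show "minimal_zero_sum G (add_mset (e t) T)" using et by (simp add: T_def)
    have "set_mset (add_mset (e t) T) \<subseteq> span {t}"
      using pw e_in_span[of t "{t}"] by (auto simp: T_def)
    then have "generate G (set_mset (add_mset (e t) T)) \<subseteq> span {t}" using sub by (rule generate_subgroup_incl)
    moreover have "span {t} \<subseteq> generate G (set_mset (add_mset (e t) T))" by (rule mono_generate) simp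
    ultimately show "generate G (set_mset (add_mset (e t) T)) = span {t}" by simp
  qed
  define A where "A = image_mset (\<lambda>a. e t [^] a) (mset_set {..<n 1 - 1})"
  define w where "w = e t \<otimes> inv (seq_sum G A)"
  have Ain: "set_mset A \<subseteq> span {t}" using pw by (auto simp: A_def)
  have Ac: "set_mset A \<subseteq> carrier G" using et by (auto simp: A_def)
  have win: "w \<in> span {t}" unfolding w_def
    using sub seq_sum_in_subgroup[OF sub Ain] e_in_span[of t "{t}"]
    by (simp add: subgroup.m_closed subgroup.m_inv_closed)
  have "seq_sum G (add_mset w A) = e t"
    using win span_carrier[OF tr(1)] Ac et by (subst seq_sum_add_mset) (auto simp: w_def m_assoc)
  then have "spanning {1, t} (T + image_mset (\<lambda>h. e 1 \<otimes> h) (add_mset w A))"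
    using n1 win Ain by (intro spanning_replace[OF tr T]) (auto simp: A_def)
  then have S1: "spanning {1, t} (add_mset (e 1 \<otimes> w) (T + image_mset (\<lambda>h. e 1 \<otimes> h) A))" by simp
  have z: "e 1 \<otimes> w \<notin> generate G {e t}"
    using translate_notin_span[OF tr win] by simp
  have "n 1 * n t \<le> card (span {1, t})" using card_span_ge[of "{1,t}"] t by auto
  then have small: "n p < card (span {1, t})" using np by simp
  obtain B where B: "finite B" "card B = n p" "B \<inter> span {1, t} = {}"
    "spanning (insert p {1, t}) (T + image_mset (\<lambda>h. e 1 \<otimes> h) A + mset_set B)"
  proof (rule spanning_replace_distinct[OF _ _ S1 _ z small])
    show "n p dvd ord (e t) \<or> ord (e t) dvd n p \<and> (\<forall>i\<in>{1, t}. n i dvd ord (e t))"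
      using np ot n_dvd[of 1 t] t by auto
    show "e t \<in> span {1, t}" by (rule e_in_span) simp
  qed (use t p in auto)
  define D where "D = (\<lambda>a. e 1 \<otimes> e t [^] a) ` {..<n 1 - 1}"
  have injt: "inj_on (\<lambda>a. e t [^] a) {..<n t}"
    using ord_inj[OF et] unfolding ot by (rule inj_on_subset) (use n1 in auto)
  have inj1: "inj_on (\<lambda>a. e 1 \<otimes> e t [^] a) {..<n 1 - 1}"
    using injt n1 n1t e1 et by (auto simp: inj_on_def)
  have "image_mset (\<lambda>h. e 1 \<otimes> h) A = image_mset (\<lambda>a. e 1 \<otimes> e t [^] a) (mset_set {..<n 1 - 1})"
    by (simp add: A_def image_mset.compositionality o_def)
  also have "\<dots> = mset_set D" unfolding D_def using inj1 by (rule image_mset_mset_set)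
  finally have AD: "image_mset (\<lambda>h. e 1 \<otimes> h) A = mset_set D" .
  have D: "finite D" "card D = n 1 - 1" using inj1 by (auto simp: D_def card_image)
  have Dt: "D \<inter> span {t} = {}" using translate_notin_span[OF tr pw] by (auto simp: D_def)
  have sub1: "subgroup (span {1, t}) G" using t by (intro subgroup_span) auto
  have t1: "span {t} \<subseteq> span {1, t}" by (rule span_mono) auto
  have "e 1 \<otimes> e t [^] a \<in> span {1, t}" for a :: nat
    using subsetD[OF t1 pw] by (intro subgroup.m_closed[OF sub1] e_in_span) auto
  then have D1: "D \<subseteq> span {1, t}" by (auto simp: D_def)
  have Tt: "set_mset T \<subseteq> span {t}" using spanning_in_span[OF T] by simp
  have BD: "B \<inter> D = {}" using B D1 by auto
  have disj: "set_mset T \<inter> (D \<union> B) = {}" using Tt Dt B t1 by auto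
  define S where "S = T + mset_set (D \<union> B)"
  have Seq: "T + image_mset (\<lambda>h. e 1 \<otimes> h) A + mset_set B = S"
    using AD D B BD by (simp add: S_def mset_set_Union Int_commute add.assoc)
  have cDB: "card (D \<union> B) = n 1 - 1 + n p" using D B BD by (simp add: card_Un_disjoint Int_commute)
  have JN: "J \<subseteq> {..<n t}" using J member_le_sum[of _ J "\<lambda>x. x"] by fastforce
  have injJ: "inj_on (\<lambda>a. e t [^] a) J" using injt JN by (rule inj_on_subset)
  have TJ: "T = replicate_mset (n t - ?N - 1) (e t) + mset_set ((\<lambda>a. e t [^] a) ` J)"
    using injJ et by (simp add: T_def M0_def image_mset_mset_set)
  have "card J = card ((\<lambda>a. e t [^] a) ` J)" using injJ by (simp add: card_image)
  also have "\<dots> \<le> card (set_mset T)" using J by (intro card_mono) (auto simp: T_def M0_def)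
  finally have cT: "card J \<le> card (set_mset T)" .
  have sT: "size T = n t - ?N - 1 + card J" by (simp add: T_def M0_def)
  have cS: "card (set_mset S) = card (set_mset T) + (n 1 - 1 + n p)"
    using disj D B cDB by (simp add: S_def card_Un_disjoint)
  have sS: "size S = n t - ?N + card J + (n 1 - 1) + (n p - 1)"
    using sT cDB J n1 by (simp add: S_def)
  have "y = e t" if "2 \<le> count S y" for y
  proof (rule ccontr)
    assume y: "y \<noteq> e t"
    have le1: "count (mset_set X) y \<le> 1" for X by (simp add: count_mset_set')
    have "count T y \<le> 1" using y le1 by (simp add: TJ)
    moreover have "count T y = 0 \<or> count (mset_set (D \<union> B)) y = 0"
      using disj D B by (auto simp: not_in_iff[symmetric])
    ultimately have "count S y \<le> 1" using le1 unfolding S_def by auto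
    then show False using that by simp
  qed
  moreover have "insert p {1, t} = {1, p, t}" by auto
  ultimately show ?thesis unfolding attains_def
    using B(4) Seq sS cS cT n1 J by (intro exI[of _ S]) auto
qed

text \<open>
  After \<open>t\<close> and \<open>1\<close>, the indices are added in increasing order; the first of them is called \<open>p\<close>.
  For the later indices \<open>s\<close> below \<open>t\<close>, a subgroup of order \<open>n s\<close> is found in the one of \<open>e 1 \<otimes> e t\<close>. Above \<open>t\<close>, all indices
  below \<open>s\<close> are present, so the hypothesis on \<open>n s\<close> leaves room for \<open>n s\<close> elements, and the subgroup
  of \<open>e 1 \<otimes> e (s - 1)\<close> has the exponent of \<open>span {1..s - 1}\<close> as its order. In both cases the second
  factor is \<open>e u\<close> with \<open>u = max t (s - 1)\<close>.
\<close>

lemma attains_all: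
  assumes r: "3 \<le> r" and t: "t \<in> {2..r}"
    and small: "\<And>s. s \<in> {t + 1..r} \<Longrightarrow> n s < (\<Prod>i=1..s - 1. n i)"
    and J: "finite J" "0 \<notin> J" "\<Sum>J < n t"
  shows "attains t {1..r} (n t - \<Sum>J + card J + (\<Sum>i\<in>{1..r} - {t}. n i - 1)) (n t - \<Sum>J + 2 - r)"
proof -
  define p where "p = (if t = 2 then 3 else 2 :: nat)"
  let ?I = "\<lambda>s. insert t {1..s}"
  let ?P = "\<lambda>s. attains t (?I s) (n t - \<Sum>J + card J + (\<Sum>i\<in>?I s - {t}. n i - 1))
     (n t - \<Sum>J + 2 - card (?I s))"
  have n1: "1 < n 1" "1 < n t" using n_gt_1 t by auto
  have pr: "p \<le> r" using r by (simp add: p_def)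
  have "?P r"
    using pr
  proof (induction r rule: dec_induct)
    case base
    have I: "?I p = {1, p, t}" "?I p - {t} = {1, p}" using t by (auto simp: p_def)
    have np: "(n p dvd n t \<or> n t dvd n p) \<and> n p < n 1 * n t"
    proof (cases "t = 2")
      case True
      then have "{1..t} = {1, t}" by auto
      then show ?thesis using True r n_dvd[of 2 3] small[of 3] by (auto simp: p_def)
    next
      case False
      then have d: "n 2 dvd n t" using t by (intro n_dvd) auto
      then have "n 2 \<le> n t" using n1 by (intro dvd_imp_le) auto
      also have "n t < n 1 * n t" using n1 by simp
      finally show ?thesis using d False by (simp add: p_def)
    qed
    have p: "p \<in> {2..r} - {t}" using r t by (auto simp: p_def)
    then have "card {1, p, t} = 3" "p \<noteq> 1" using t by auto
    then show ?case using attains_initial[OF t p J] np unfolding I(2) unfolding I(1) by (simp add: add.assoc)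
  next
    case (step s)
    show ?case
    proof (cases "Suc s = t")
      case True
      then have "?I (Suc s) = ?I s" by auto
      then show ?thesis using step by simp
    next
      case False
      have p2: "2 \<le> p" by (simp add: p_def)
      define u where "u = max t s"
      let ?x = "e 1 \<otimes> e u"
      have sr: "Suc s \<le> r" "2 \<le> s" using step p2 by auto
      have u: "u \<in> {2..r}" "t \<le> u" "u \<in> ?I s" using sr t by (auto simp: u_def max_def)
      have I: "?I s \<subseteq> {1..r}" "t \<in> ?I s" using sr t by auto
      have sI: "Suc s \<in> {1..r} - ?I s" using sr False by auto
      have ox: "ord ?x = n u" using u by (intro ord_e1_e)
      have "1 \<in> ?I s" using sr by auto
      then have x: "?x \<in> span (?I s)"
        by (intro subgroup.m_closed[OF subgroup_span[OF I(1)]] e_in_span u(3))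
      have et: "e t \<notin> generate G {?x}" using t u by (intro e_notin_generate_e1_e) auto
      have "n (Suc s) < card (span (?I s)) \<and> (n (Suc s) dvd n u \<or> n u dvd n (Suc s) \<and> (\<forall>i\<in>?I s. n i dvd n u))"
      proof (cases "Suc s < t")
        case True
        then have ut: "u = t" by (simp add: u_def)
        have d: "n (Suc s) dvd n t" using True t by (intro n_dvd) auto
        then have "n (Suc s) \<le> n t" using n1 by (intro dvd_imp_le) auto
        also have "n t < n 1 * n t" using n1 by simp
        also have "\<dots> = (\<Prod>i\<in>{1, t}. n i)" using t by auto
        also have "\<dots> \<le> card (span {1, t})" using t by (intro card_span_ge) auto
        also have "\<dots> \<le> card (span (?I s))"
          using finite_span[OF I(1)] sr by (intro card_mono span_mono) auto
        finally show ?thesis using d ut by simp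
      next
        case False
        then have st: "t < Suc s" using \<open>Suc s \<noteq> t\<close> by simp
        then have us: "u = s" "?I s = {1..s}" using t by (auto simp: u_def)
        have "n (Suc s) < (\<Prod>i=1..s. n i)" using small[of "Suc s"] st sr by auto
        also have "\<dots> \<le> card (span (?I s))" using card_span_ge[OF I(1), unfolded us(2)] unfolding us(2) .
        finally have "n (Suc s) < card (span (?I s))" .
        moreover have "n u dvd n (Suc s) \<and> (\<forall>i\<in>?I s. n i dvd n u)"
          unfolding us using sr n_dvd[of s "Suc s"] n_dvd[of _ s] by auto
        ultimately show ?thesis by blast
      qed
      then have "attains t (insert (Suc s) (?I s))
         (n t - \<Sum>J + card J + (\<Sum>i\<in>?I s - {t}. n i - 1) + (n (Suc s) - 1)) (n t - \<Sum>J + 2 - card (?I s) - 1)"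
        using ox by (intro attains_extend[OF I sI _ x et]) (use step in auto)
      moreover have "insert (Suc s) (?I s) = ?I (Suc s)" by auto
      moreover have "?I (Suc s) - {t} = insert (Suc s) (?I s - {t})" using False by auto
      moreover have "card (?I (Suc s)) = card (?I s) + 1"
        using sI card_insert_disjoint[of "?I s" "Suc s"] by (simp add: insert_commute atLeastAtMostSuc_conv)
      moreover have "Suc s \<notin> ?I s - {t}" using sI by auto
      ultimately show ?thesis by (simp add: add.commute add.left_commute)
    qed
  qed
  moreover have "?I r = {1..r}" using t by auto
  ultimately show ?thesis by simp
qed

end

section \<open>Groups with given invariant factors\<close>

text \<open>
  The standard unit vectors are pulled back along the isomorphism. Independence holds because the
  coordinate at \<open>s\<close> vanishes on the subgroup generated by the other unit vectors.
\<close>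

lemma invariant_factors_imp_independent_family:
  fixes G :: "('a, 'b) monoid_scheme" (structure)
  assumes "comm_group G" "invariant_factors G r n"
  shows "\<exists>e. independent_family G e n r"
proof -
  interpret comm_group G by fact
  let ?A = "sum_group {1..r} (\<lambda>i. integer_mod_group (n i))"
  have n: "\<And>i. i \<in> {1..r} \<Longrightarrow> 1 < n i" and cn: "\<forall>i\<in>{1..<r}. n i dvd n (Suc i)"
    using assms(2) by (auto simp: invariant_factors_def)
  obtain h where h: "h \<in> hom G ?A" and bij: "bij_betw h (carrier G) (carrier ?A)"
    using assms(2) by (auto simp: invariant_factors_def is_iso_def iso_def)
  interpret h: group_hom G ?A h
    using h by (simp add: group_hom_def group_hom_axioms_def is_group)
  have carr: "carrier ?A = (\<Pi>\<^sub>E i\<in>{1..r}. carrier (integer_mod_group (n i)))"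
    by (simp add: carrier_sum_group)
  have Z: "carrier (integer_mod_group (n i)) = {0..<int (n i)}" if "i \<in> {1..r}" for i
    using n[OF that] by (simp add: carrier_integer_mod_group)
  have one: "\<one>\<^bsub>?A\<^esub> = (\<lambda>i\<in>{1..r}. 0)" by simp
  have pow: "x [^]\<^bsub>?A\<^esub> m = (\<lambda>i\<in>{1..r}. x i [^]\<^bsub>integer_mod_group (n i)\<^esub> m)" for x and m :: nat
    by (induction m) (auto simp del: pow_integer_mod_group)
  define d :: "nat \<Rightarrow> nat \<Rightarrow> int" where "d i = (\<lambda>j\<in>{1..r}. if j = i then 1 else 0)" for i
  define e where "e i = inv_into (carrier G) h (d i)" for i
  have dA: "d i \<in> carrier ?A" for i
    unfolding carr d_def using n Z by (force simp: PiE_iff)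
  have e: "e i \<in> carrier G" "h (e i) = d i" for i
    using dA[of i] bij unfolding e_def bij_betw_def by (auto simp: inv_into_into f_inv_into_f)
  have he: "h (e i [^] m) s = (if s = i then int m mod int (n s) else 0)" if "s \<in> {1..r}" for i s and m :: nat
  proof -
    have "h (e i [^] m) = d i [^]\<^bsub>?A\<^esub> m" using e by (simp only: h.hom_nat_pow)
    then show ?thesis unfolding pow using that by (simp add: d_def)
  qed
  have "finite (carrier ?A)" unfolding carr using Z by (intro finite_PiE) auto
  then have fin: "finite (carrier G)" using bij bij_betw_finite by blast
  show ?thesis
  proof (intro exI[of _ e], unfold_locales)
    show "finite (carrier G)" by (rule fin)
    show "e i \<in> carrier G" for i by (rule e)
    show "1 < n i" if "i \<in> {1..r}" for i using n that .
    show "n i dvd n j" if "1 \<le> i" "i \<le> j" "j \<le> r" for i j using chain_dvd[OF cn that] .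
    show "e i [^] n i = \<one>" if i: "i \<in> {1..r}" for i
    proof -
      have "h (e i [^] n i) \<in> carrier ?A" "h \<one> \<in> carrier ?A" using e(1) by (intro h.hom_closed; simp)+
      then have "h (e i [^] n i) = h \<one>"
        unfolding carr by (rule PiE_ext) (auto simp: he h.hom_one)
      then show ?thesis using bij e by (simp add: bij_betw_def inj_on_def)
    qed
    fix s I j assume s: "s \<in> {1..r}" and I: "I \<subseteq> {1..r} - {s}" and j: "e s [^] (j::nat) \<in> generate G (e ` I)"
    let ?K = "{x \<in> carrier G. h x s = 0}"
    have range: "0 \<le> h x s \<and> h x s < int (n s)" if "x \<in> carrier G" for x
      using h.hom_closed[OF that] s Z[OF s] unfolding carr by (auto simp: PiE_iff)
    have mult: "h (x \<otimes> y) s = (h x s + h y s) mod int (n s)" if "x \<in> carrier G" "y \<in> carrier G" for x y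
      using that s n[OF s] by (simp add: h.hom_mult)
    have "subgroup ?K G"
    proof (rule subgroupI)
      show "?K \<noteq> {}" using s by (auto intro!: exI[of _ \<one>] simp: h.hom_one)
      show "inv x \<in> ?K" if "x \<in> ?K" for x
        using that mult[of x "inv x"] s range[of "inv x"] by (simp add: h.hom_one)
      show "x \<otimes> y \<in> ?K" if "x \<in> ?K" "y \<in> ?K" for x y
        using that mult[of x y] by simp
    qed auto
    moreover have "e ` I \<subseteq> ?K" using I s e by (auto simp: d_def)
    ultimately have "generate G (e ` I) \<subseteq> ?K" by (rule generate_subgroup_incl[rotated])
    then have "h (e s [^] j) s = 0" using j by auto
    then have "int j mod int (n s) = 0" using he[OF s] by simp
    then show "n s dvd j" by (simp add: mod_eq_0_iff_dvd)
  qed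
qed

section \<open>The lower bound\<close>

text \<open>
  The number \<open>x\<close> under the floor is the non-negative solution of \<open>x * (x + 1) = 2 * N\<close>. Its floor is
  therefore the largest number of distinct positive integers with sum at most \<open>N\<close>.
\<close>

lemma floor_triangular_root:
  fixes N :: nat
  defines "f \<equiv> nat \<lfloor>(- 1 + sqrt (1 + 8 * real N)) / 2\<rfloor>"
  shows "int f = \<lfloor>(- 1 + sqrt (1 + 8 * real N)) / 2\<rfloor>" "f * (f + 1) \<le> 2 * N" "0 < N \<Longrightarrow> 0 < f"
proof -
  define x where "x = (- 1 + sqrt (1 + 8 * real N)) / 2"
  have x0: "0 \<le> x" by (simp add: x_def)
  show f: "int f = \<lfloor>(- 1 + sqrt (1 + 8 * real N)) / 2\<rfloor>" using x0 by (simp add: f_def x_def[symmetric])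
  have fx: "real f \<le> x" using f unfolding x_def[symmetric] by linarith
  have "2 * x + 1 = sqrt (1 + 8 * real N)" by (simp add: x_def field_simps)
  then have "(2 * x + 1)\<^sup>2 = 1 + 8 * real N" by simp
  then have xx: "x * (x + 1) = 2 * real N" by (simp add: power2_eq_square algebra_simps)
  have "real f * (real f + 1) \<le> x * (x + 1)" using fx x0 by (intro mult_mono) auto
  then have "real (f * (f + 1)) \<le> real (2 * N)" using xx by (simp add: algebra_simps)
  then show "f * (f + 1) \<le> 2 * N" by (simp only: of_nat_le_iff)
  assume "0 < N"
  then have "sqrt (3\<^sup>2) \<le> sqrt (1 + 8 * real N)" by (intro real_sqrt_le_mono) simp
  then have "1 \<le> x" by (simp add: x_def)
  then show "0 < f" unfolding f_def x_def[symmetric] by simp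
qed

theorem corollary5p4:
  fixes G :: "('a, 'b) monoid_scheme" and r t k :: nat and n :: "nat \<Rightarrow> nat"
  assumes "comm_group G"
    and "r \<ge> 3"
    and "invariant_factors G r n"
    and "t \<in> {2..r}"
    and "\<forall>s\<in>{t + 1..r}. n s < (\<Prod>i=1..s - 1. n i)"
  shows "int (strong_davenport k G) \<ge>
           int (Dstar G) -
           max 0 (int (n t) - int k - int r + 2 -
                  \<lfloor>(- 1 + sqrt (1 + 8 * real_of_int (max 0 (int (n t) - int k - int r + 2)))) / 2\<rfloor>)
         \<and> (int r \<ge> int (n t) + 1 - int k \<longrightarrow> strong_davenport k G \<ge> Dstar G)"
proof -
  obtain e where "independent_family G e n r"
    using invariant_factors_imp_independent_family assms(1,3) by blast
  then interpret independent_family G e n r .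
  define x where "x = int (n t) - int k - int r + 2"
  \<comment> \<open>\<open>N\<close> is the amount by which the copies of \<open>e t\<close> exceed the budget: \<open>n t - r + 2\<close> copies would
    remain, allowing for a negative number, while \<open>k\<close> are affordable.\<close>
  define N where "N = nat (max 0 x)"
  define f where "f = nat \<lfloor>(- 1 + sqrt (1 + 8 * real N)) / 2\<rfloor>"
  have N: "int N = max 0 x" by (simp add: N_def)
  have nt: "1 < n t" using n_gt_1 assms(4) by auto
  have Nt: "N < n t" using N nt assms(2) by (auto simp: x_def max_def split: if_splits)
  have f: "int f = \<lfloor>(- 1 + sqrt (1 + 8 * real_of_int (max 0 x))) / 2\<rfloor>"
    "f * (f + 1) \<le> 2 * N" "0 < N \<Longrightarrow> 0 < f"
    using floor_triangular_root[of N] N[symmetric] by (simp_all add: f_def)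
  obtain J where J: "finite J" "card J = f" "\<Sum>J = N" "0 \<notin> J"
    using distinct_summands[OF f(2,3)] by blast
  obtain S where S: "minimal_zero_sum G S"
    "size S = n t - N + f + (\<Sum>i\<in>{1..r} - {t}. n i - 1)"
    "size S \<le> card (set_mset S) + (n t - N + 2 - r)"
    using attains_all[OF assms(2,4) _ J(1,4)] assms(5) J Nt unfolding attains_def spanning_def by auto
  have "n t - N + 2 - r \<le> k" using N Nt by (auto simp: x_def)
  then have "size S \<le> strong_davenport k G"
    using strong_davenport_ge[OF finite_carrier S(1)] S(3) by simp
  moreover have "int (size S) = int (Dstar G) - int N + int f"
  proof -
    have "Dstar G = 1 + (n t - 1) + (\<Sum>i\<in>{1..r} - {t}. n i - 1)"
      using Dstar_eq[OF is_group assms(3)] sum.remove[of "{1..r}" t "\<lambda>i. n i - 1"] assms(4) by simp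
    then show ?thesis using S(2) Nt nt by simp
  qed
  ultimately have ge: "int (strong_davenport k G) \<ge> int (Dstar G) - (int N - int f)" by linarith
  have "int N - int f \<le> max 0 (x - int f)" using N by linarith
  moreover have "int N - int f \<le> 0" if "int r \<ge> int (n t) + 1 - int k"
  proof -
    have "N \<le> 1" using that N by (simp add: x_def)
    then show ?thesis using f(3) by (cases "N = 0") auto
  qed
  ultimately show ?thesis using ge unfolding x_def[symmetric] f(1)[symmetric] by fastforce
qed

end
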